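(* Let $\mu$ be a partition with $\ell\ge1$ parts, let $d\ge0$, and let $\lambda=(\mu_1+d,\ldots,\mu_1+d,\mu_1+d,\mu_2+d,\ldots,\mu_\ell+d)$ (with $d$ initial parts equal to $\mu_1+d$). Then \[ \sum_{D\in\mathcal{E}(\lambda/\mu)}\ \prod_{(i,j)\in D}(x_i-y_j)=\det\bigl[A_{i,j}\bigr]_{i,j=1}^{d+\ell}, \] where \[ A_{i,j}=\begin{cases}\dfrac{(x_i-y_1)\cdots(x_i-y_{d+\ell-j})}{(x_i-x_{i+1})\cdots(x_i-x_{d+\ell})} & \text{if } j>\ell,\\[2mm] \dfrac{(x_i-y_1)\cdots(x_i-y_{\mu_j+d})}{(x_i-x_{i+1})\cdots(x_i-x_{d+j})} & \text{if } i-d\le j\le\ell,\\[2mm] 0 & \text{if } j<i-d,\end{cases} \] with empty products equal to $1$.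
   Context: $x_i,y_j$ are indeterminates. Excited diagrams $\mathcal{E}(\lambda/\mu)$: subsets of $[\lambda]$ obtained from $[\mu]$ by repeatedly replacing a cell $(i,j)\in D$ (row $i$, column $j$) by $(i+1,j+1)$ whenever $(i+1,j),(i,j+1),(i+1,j+1)$ lie in $[\lambda]\setminus D$. (In the paper the left side is phrased as the partition function of lozenge tilings with base $\mu$ and height $d$ (equivalently plane partitions of shape $\mu$ with entries at most $d$), where a horizontal lozenge at position $(i,j)$ has weight $x_i-y_j$; these tilings are in bijection with $\mathcal{E}(\lambda/\mu)$, cells of $D$ corresponding to horizontal lozenges at the same position.) *)

theory Defs
  imports "Jordan_Normal_Form.Determinant"
begin

text \<open>A partition is the list of its parts, which are positive and weakly decreasing. Rows,
  columns and the indices of the sequences \<open>x\<close>, \<open>y\<close> are counted from 1, lists from 0.\<close>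

definition is_partition :: "nat list \<Rightarrow> bool" where
  "is_partition \<mu> \<longleftrightarrow> sorted_wrt (\<ge>) \<mu> \<and> (\<forall>p \<in> set \<mu>. 0 < p)"

definition diagram :: "nat list \<Rightarrow> (nat \<times> nat) set" where
  "diagram \<mu> = {(i, j). 1 \<le> i \<and> i \<le> length \<mu> \<and> 1 \<le> j \<and> j \<le> \<mu> ! (i - 1)}"

inductive_set excited_diagrams :: "nat list \<Rightarrow> nat list \<Rightarrow> (nat \<times> nat) set set"
  for \<Lambda> \<mu> :: "nat list" where
  base: "diagram \<mu> \<in> excited_diagrams \<Lambda> \<mu>"
| excite: "insert (i + 1, j + 1) (D - {(i, j)}) \<in> excited_diagrams \<Lambda> \<mu>"
    if "D \<in> excited_diagrams \<Lambda> \<mu>" and "(i, j) \<in> D"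
      and "{(i + 1, j), (i, j + 1), (i + 1, j + 1)} \<subseteq> diagram \<Lambda> - D"

definition outer_shape :: "nat list \<Rightarrow> nat \<Rightarrow> nat list" where
  "outer_shape \<mu> d = replicate d (\<mu> ! 0 + d) @ map (\<lambda>p. p + d) \<mu>"

text \<open>The condition \<open>i \<le> j + d\<close> is \<open>i - d \<le> j\<close> without truncated subtraction. The indeterminates
  are rendered as arbitrary elements of an arbitrary field; the denominators do not vanish when
  \<open>x\<close> is injective on \<open>{1..d + l}\<close>. A field of rational functions is one instance.\<close>

definition A_entry ::
    "(nat \<Rightarrow> 'a::field) \<Rightarrow> (nat \<Rightarrow> 'a) \<Rightarrow> nat list \<Rightarrow> nat \<Rightarrow> nat \<Rightarrow> nat \<Rightarrow> 'a" where
  "A_entry x y \<mu> d i j =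
    (let l = length \<mu> in
     if j > l then
       (\<Prod>k = 1..d + l - j. x i - y k) / (\<Prod>k = i + 1..d + l. x i - x k)
     else if i \<le> j + d then
       (\<Prod>k = 1..\<mu> ! (j - 1) + d. x i - y k) / (\<Prod>k = i + 1..d + j. x i - x k)
     else 0)"

lemma finite_diagram: "finite (diagram \<mu>)"
proof -
  have "diagram \<mu> = (\<Union>i \<in> {1..length \<mu>}. {i} \<times> {1..\<mu> ! (i - 1)})"
    by (auto simp: diagram_def)
  then show ?thesis by simp
qed

lemma excited_diagrams_subset:
  "D \<in> excited_diagrams \<Lambda> \<mu> \<Longrightarrow> D \<subseteq> diagram \<mu> \<union> diagram \<Lambda>"
  by (induction rule: excited_diagrams.induct) auto

text \<open>Hence sums over \<open>excited_diagrams\<close> and products over its members are genuine finite ones.\<close>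

lemma finite_excited_diagrams: "finite (excited_diagrams \<Lambda> \<mu>)"
proof (rule finite_subset)
  show "excited_diagrams \<Lambda> \<mu> \<subseteq> Pow (diagram \<mu> \<union> diagram \<Lambda>)"
    using excited_diagrams_subset by blast
qed (simp add: finite_diagram)

lemma finite_excited_diagram: "D \<in> excited_diagrams \<Lambda> \<mu> \<Longrightarrow> finite D"
  by (meson excited_diagrams_subset finite_UnI finite_diagram finite_subset)

end

theory Submission imports Defs "HOL-Library.Product_Order" begin

text \<open>Sliding the cell \<open>(i, j)\<close> of \<open>\<mu>\<close> down its diagonal by \<open>k (i, j)\<close> steps identifies the
  excited diagrams with the reverse plane partitions \<open>k\<close> of shape \<open>\<mu>\<close> with entries at most \<open>d\<close>; an
  excitation increases one entry of \<open>k\<close>. To induct, allow a separate bound \<open>c\<^sub>i\<close> in each row \<open>i\<close>.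
  The matching determinant has in column \<open>j\<close> the vector \<open>w (\<mu>\<^sub>j + c\<^sub>j) (j + c\<^sub>j)\<close>, where \<open>w a b\<close>
  has the \<open>i\<close>-th coordinate
  \<open>(x\<^sub>i - y\<^sub>1) \<cdots> (x\<^sub>i - y\<^sub>a) / ((x\<^sub>i - x\<^sub>i\<^sub>+\<^sub>1) \<cdots> (x\<^sub>i - x\<^sub>b))\<close>, and 0 for \<open>i > b\<close>.

  Let \<open>r\<close> be the first descent of \<open>c\<close>. If \<open>\<mu>\<^sub>r > \<mu>\<^sub>r\<^sub>+\<^sub>1\<close>, the corner of row \<open>r\<close> either has an entry
  below \<open>c\<^sub>r\<close>, so that the bound may be lowered, or has the entry \<open>c\<^sub>r\<close> and can be removed; on the
  determinant side this is \<open>w (a + 1) b = w a (b - 1) + (x\<^sub>b - y\<^sub>a\<^sub>+\<^sub>1) w a b\<close> applied to column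
  \<open>r\<close>. If \<open>\<mu>\<^sub>r = \<mu>\<^sub>r\<^sub>+\<^sub>1\<close>, row \<open>r + 1\<close> already forces the lower bound on row \<open>r\<close>, while the
  second term of the recurrence repeats column \<open>r + 1\<close>. Without a descent \<open>c = 0\<close>, and the matrix
  is triangular.\<close>

section \<open>Monotone functions\<close>

lemma monotone_on_fun_upd:
  assumes "monotone_on (A - {a}) orda ordb f" and "ordb b b"
    and "\<And>x. x \<in> A \<Longrightarrow> x \<noteq> a \<Longrightarrow> orda x a \<Longrightarrow> ordb (f x) b"
    and "\<And>x. x \<in> A \<Longrightarrow> x \<noteq> a \<Longrightarrow> orda a x \<Longrightarrow> ordb b (f x)"
  shows "monotone_on A orda ordb (f(a := b))"
  using assms by (auto simp: monotone_on_def)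

lemma mono_on_first_descent:
  fixes f :: "nat \<Rightarrow> 'a::linorder"
  assumes "\<not> mono_on {1..n} f"
  obtains r where "1 \<le> r" and "r < n" and "mono_on {1..r} f" and "f (Suc r) < f r"
  using assms
proof (induction n arbitrary: thesis)
  case 0
  then show ?case by (simp add: monotone_on_def)
next
  case (Suc n)
  show ?case
  proof (cases "mono_on {1..n} f")
    case True
    have "f (Suc n) < f n \<and> 1 \<le> n"
    proof (rule ccontr)
      assume last: "\<not> ?thesis"
      have "f i \<le> f (Suc n)" if "1 \<le> i" "i \<le> n" for i
        using monotone_onD[OF True, of i n] that last by auto
      then have "mono_on {1..Suc n} (f(Suc n := f (Suc n)))"
        by (intro monotone_on_fun_upd) (use True in \<open>auto simp: monotone_on_def le_Suc_eq\<close>)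
      then show False using Suc.prems(2) by simp
    qed
    then show thesis using Suc.prems(1)[of n] True by blast
  next
    case False
    show thesis by (rule Suc.IH[OF _ False]) (use Suc.prems(1) less_SucI in blast)
  qed
qed

lemma sum_decrement_less:
  fixes f :: "'a \<Rightarrow> nat"
  assumes "finite A" and "a \<in> A" and "0 < f a"
  shows "(\<Sum>x \<in> A. (f(a := f a - 1)) x) < (\<Sum>x \<in> A. f x)"
  by (rule sum_strict_mono_ex1) (use assms in auto)

section \<open>Reverse plane partitions\<close>

definition rpps :: "'a::order set \<Rightarrow> ('a \<Rightarrow> nat) set" where
  "rpps C = {k. mono_on C k \<and> (\<forall>p. p \<notin> C \<longrightarrow> k p = 0)}"

definition row_bounded_rpps :: "(nat \<times> nat) set \<Rightarrow> (nat \<Rightarrow> nat) \<Rightarrow> (nat \<times> nat \<Rightarrow> nat) set" where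
  "row_bounded_rpps C c = {k \<in> rpps C. \<forall>p \<in> C. k p \<le> c (fst p)}"

definition slide :: "(nat \<times> nat \<Rightarrow> nat) \<Rightarrow> nat \<times> nat \<Rightarrow> nat \<times> nat" where
  "slide k p = p + (k p, k p)"

definition rpp_sum ::
    "(nat \<times> nat \<Rightarrow> 'a::comm_semiring_1) \<Rightarrow> (nat \<times> nat) set \<Rightarrow> (nat \<Rightarrow> nat) \<Rightarrow> 'a" where
  "rpp_sum w C c = (\<Sum>k \<in> row_bounded_rpps C c. \<Prod>p \<in> C. w (slide k p))"

lemma rpps_mono: "k \<in> rpps C \<Longrightarrow> p \<in> C \<Longrightarrow> q \<in> C \<Longrightarrow> p \<le> q \<Longrightarrow> k p \<le> k q"
  by (simp add: rpps_def monotone_on_def)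

lemma rpps_outside: "k \<in> rpps C \<Longrightarrow> p \<notin> C \<Longrightarrow> k p = 0"
  by (simp add: rpps_def)

lemma zero_in_rpps: "(\<lambda>p. 0) \<in> rpps C"
  by (simp add: rpps_def monotone_on_def)

lemma rpps_eqI:
  assumes "k \<in> rpps C" and "h \<in> rpps C" and "\<And>p. p \<in> C \<Longrightarrow> k p = h p"
  shows "k = h"
  using assms rpps_outside by (metis ext)

lemma rpps_fun_upd:
  assumes "k \<in> rpps C \<or> k \<in> rpps (C - {p})" and "p \<in> C"
    and "\<And>q. q \<in> C \<Longrightarrow> q < p \<Longrightarrow> k q \<le> v" and "\<And>q. q \<in> C \<Longrightarrow> p < q \<Longrightarrow> v \<le> k q"
  shows "k(p := v) \<in> rpps C"
proof -
  have "mono_on (C - {p}) k"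
    using assms(1) by (auto simp: rpps_def intro: monotone_on_subset)
  then have "mono_on C (k(p := v))"
    by (rule monotone_on_fun_upd) (use assms(3,4) in auto)
  then show ?thesis
    using assms(1,2) by (auto simp: rpps_def)
qed

lemma rpps_remove: "k \<in> rpps C \<Longrightarrow> k(p := 0) \<in> rpps (C - {p})"
  by (simp add: rpps_def monotone_on_def)

lemma row_bounded_rppsI:
  "k \<in> rpps C \<Longrightarrow> (\<And>p. p \<in> C \<Longrightarrow> k p \<le> c (fst p)) \<Longrightarrow> k \<in> row_bounded_rpps C c"
  by (simp add: row_bounded_rpps_def)

lemma row_bounded_rppsD:
  assumes "k \<in> row_bounded_rpps C c"
  shows "k \<in> rpps C" and "p \<in> C \<Longrightarrow> k p \<le> c (fst p)"
  using assms by (simp_all add: row_bounded_rpps_def)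

lemma finite_row_bounded_rpps:
  assumes "finite C"
  shows "finite (row_bounded_rpps C c)"
proof (rule finite_subset)
  let ?B = "\<Union>p \<in> C. {..c (fst p)}"
  show "row_bounded_rpps C c \<subseteq> {k. \<forall>p. (p \<in> C \<longrightarrow> k p \<in> ?B) \<and> (p \<notin> C \<longrightarrow> k p = 0)}"
    by (auto dest: row_bounded_rppsD rpps_outside)
  show "finite \<dots>"
    by (rule finite_set_of_finite_funs) (use assms in auto)
qed

lemma row_bounded_rpps_lower_row:
  assumes "t \<le> c r"
  shows "row_bounded_rpps C (c(r := t)) = {k \<in> row_bounded_rpps C c. \<forall>p \<in> C. fst p = r \<longrightarrow> k p \<le> t}"
proof -
  have "k p \<le> (c(r := t)) (fst p) \<longleftrightarrow> k p \<le> c (fst p) \<and> (fst p = r \<longrightarrow> k p \<le> t)"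
    for k :: "nat \<times> nat \<Rightarrow> nat" and p
    using assms by auto
  then show ?thesis by (auto simp: row_bounded_rpps_def)
qed

lemma rpp_sum_zero_bound:
  assumes "\<And>p. p \<in> C \<Longrightarrow> c (fst p) = 0"
  shows "rpp_sum w C c = (\<Prod>p \<in> C. w p)"
proof -
  have "k = (\<lambda>p. 0)" if k: "k \<in> row_bounded_rpps C c" for k
    by (rule rpps_eqI[OF row_bounded_rppsD(1)[OF k] zero_in_rpps])
      (use row_bounded_rppsD(2)[OF k] assms in fastforce)
  then have "row_bounded_rpps C c = {\<lambda>p. 0}"
    by (auto intro: row_bounded_rppsI zero_in_rpps)
  then show ?thesis by (simp add: rpp_sum_def slide_def flip: zero_prod_def)
qed

lemma bij_betw_insert_corner:
  assumes p: "p \<in> C" and corner: "\<And>q. q \<in> C \<Longrightarrow> p \<le> q \<Longrightarrow> q = p"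
    and c: "\<And>q. q \<in> C \<Longrightarrow> q \<le> p \<Longrightarrow> c (fst q) \<le> c (fst p)"
  shows "bij_betw (\<lambda>k. k(p := c (fst p))) (row_bounded_rpps (C - {p}) c)
    {k \<in> row_bounded_rpps C c. k p = c (fst p)}"
proof (rule bij_betw_byWitness[where f' = "\<lambda>k. k(p := 0)"])
  show "\<forall>k \<in> row_bounded_rpps (C - {p}) c. (k(p := c (fst p)))(p := 0) = k"
    using rpps_outside[OF row_bounded_rppsD(1)] by fastforce
  show "\<forall>k \<in> {k \<in> row_bounded_rpps C c. k p = c (fst p)}. (k(p := 0))(p := c (fst p)) = k"
    by auto
  show "(\<lambda>k. k(p := c (fst p))) ` row_bounded_rpps (C - {p}) c
      \<subseteq> {k \<in> row_bounded_rpps C c. k p = c (fst p)}"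
  proof (intro image_subsetI CollectI conjI row_bounded_rppsI)
    fix k assume k: "k \<in> row_bounded_rpps (C - {p}) c"
    show "k(p := c (fst p)) \<in> rpps C"
    proof (rule rpps_fun_upd[OF disjI2[OF row_bounded_rppsD(1)[OF k]] p])
      fix q assume q: "q \<in> C" "q < p"
      then have "k q \<le> c (fst q)" by (intro row_bounded_rppsD(2)[OF k]) auto
      also have "\<dots> \<le> c (fst p)" using c q by auto
      finally show "k q \<le> c (fst p)" .
    qed (use corner in force)
  qed (auto dest: row_bounded_rppsD(2))
  show "(\<lambda>k. k(p := 0)) ` {k \<in> row_bounded_rpps C c. k p = c (fst p)}
      \<subseteq> row_bounded_rpps (C - {p}) c"
  proof (intro image_subsetI row_bounded_rppsI)
    fix k assume "k \<in> {k \<in> row_bounded_rpps C c. k p = c (fst p)}"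
    then have k: "k \<in> row_bounded_rpps C c" by blast
    show "k(p := 0) \<in> rpps (C - {p})" by (rule rpps_remove[OF row_bounded_rppsD(1)[OF k]])
    show "(k(p := 0)) q \<le> c (fst q)" if "q \<in> C - {p}" for q
      using row_bounded_rppsD(2)[OF k, of q] that by simp
  qed
qed

lemma row_bounded_rpps_lower_corner:
  assumes p: "p \<in> C" and corner: "\<And>q. q \<in> C \<Longrightarrow> p \<le> q \<Longrightarrow> q = p" and pos: "0 < c (fst p)"
  shows "row_bounded_rpps C (c(fst p := c (fst p) - 1))
    = row_bounded_rpps C c - {k \<in> row_bounded_rpps C c. k p = c (fst p)}"
proof -
  have "(\<forall>q \<in> C. fst q = fst p \<longrightarrow> k q \<le> c (fst p) - 1) \<longleftrightarrow> k p \<noteq> c (fst p)"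
    if k: "k \<in> row_bounded_rpps C c" for k
  proof
    assume below: "k p \<noteq> c (fst p)"
    show "\<forall>q \<in> C. fst q = fst p \<longrightarrow> k q \<le> c (fst p) - 1"
    proof (intro ballI impI)
      fix q assume q: "q \<in> C" "fst q = fst p"
      then have "q \<le> p"
        using corner[OF q(1)] by (cases "snd q \<le> snd p") (auto simp: less_eq_prod_def)
      then have "k q \<le> k p" by (rule rpps_mono[OF row_bounded_rppsD(1)[OF k] q(1) p])
      then show "k q \<le> c (fst p) - 1"
        using row_bounded_rppsD(2)[OF k p] below by linarith
    qed
  qed (use p pos in force)
  then show ?thesis by (auto simp: row_bounded_rpps_lower_row)
qed

lemma rpp_sum_remove_corner:
  assumes C: "finite C" and p: "p \<in> C" and corner: "\<And>q. q \<in> C \<Longrightarrow> p \<le> q \<Longrightarrow> q = p"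
    and c: "\<And>q. q \<in> C \<Longrightarrow> q \<le> p \<Longrightarrow> c (fst q) \<le> c (fst p)" and pos: "0 < c (fst p)"
  shows "rpp_sum w C c = rpp_sum w C (c(fst p := c (fst p) - 1))
    + w (p + (c (fst p), c (fst p))) * rpp_sum w (C - {p}) c"
proof -
  let ?v = "c (fst p)"
  let ?W = "\<lambda>k. \<Prod>q \<in> C. w (slide k q)"
  let ?full = "{k \<in> row_bounded_rpps C c. k p = ?v}"
  have not_full: "row_bounded_rpps C (c(fst p := ?v - 1)) = row_bounded_rpps C c - ?full"
    by (rule row_bounded_rpps_lower_corner) (use p corner pos in auto)
  have weight: "?W (k(p := ?v)) = w (p + (?v, ?v)) * (\<Prod>q \<in> C - {p}. w (slide k q))" for k
  proof -
    have "?W (k(p := ?v)) = w (p + (?v, ?v)) * (\<Prod>q \<in> C - {p}. w (slide (k(p := ?v)) q))"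
      using prod.remove[OF C p, of "\<lambda>q. w (slide (k(p := ?v)) q)"] by (simp add: slide_def)
    also have "(\<Prod>q \<in> C - {p}. w (slide (k(p := ?v)) q)) = (\<Prod>q \<in> C - {p}. w (slide k q))"
      by (rule prod.cong) (auto simp: slide_def)
    finally show ?thesis .
  qed
  have "rpp_sum w C c = rpp_sum w C (c(fst p := ?v - 1)) + (\<Sum>k \<in> ?full. ?W k)"
    unfolding rpp_sum_def not_full
    by (rule sum.subset_diff) (auto simp: C finite_row_bounded_rpps)
  also have "(\<Sum>k \<in> ?full. ?W k) = (\<Sum>k \<in> row_bounded_rpps (C - {p}) c. ?W (k(p := ?v)))"
    by (rule sum.reindex_bij_betw[OF bij_betw_insert_corner[of p C c, OF p corner c], symmetric])
  also have "\<dots> = w (p + (?v, ?v)) * rpp_sum w (C - {p}) c"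
    by (simp only: weight rpp_sum_def sum_distrib_left)
  finally show ?thesis .
qed

section \<open>Sums over Young diagrams\<close>

definition cells :: "nat \<Rightarrow> (nat \<Rightarrow> nat) \<Rightarrow> (nat \<times> nat) set" where
  "cells n m = (SIGMA i:{1..n}. {1..m i})"

lemma rpp_sum_cells_remove_corner:
  assumes m: "antimono_on {1..n} m" and r: "1 \<le> r" "r < n" and corner: "m (Suc r) < m r"
    and c: "mono_on {1..r} c" "0 < c r"
  shows "rpp_sum w (cells n m) c = rpp_sum w (cells n m) (c(r := c r - 1))
    + w (r + c r, m r + c r) * rpp_sum w (cells n (m(r := m r - 1))) c"
proof -
  let ?p = "(r, m r)"
  have "rpp_sum w (cells n m) c = rpp_sum w (cells n m) (c(fst ?p := c (fst ?p) - 1))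
      + w (?p + (c (fst ?p), c (fst ?p))) * rpp_sum w (cells n m - {?p}) c"
  proof (rule rpp_sum_remove_corner)
    show "q = ?p" if q: "q \<in> cells n m" "?p \<le> q" for q
    proof -
      have "fst q = r"
        using monotone_onD[OF m, of "Suc r" "fst q"] q r corner
        by (cases "fst q = r") (auto simp: cells_def)
      then show ?thesis using q by (auto simp: cells_def)
    qed
    show "c (fst q) \<le> c (fst ?p)" if "q \<in> cells n m" "q \<le> ?p" for q
      using monotone_onD[OF c(1), of "fst q" r] that r by (auto simp: cells_def)
  qed (use r corner c in \<open>auto simp: cells_def\<close>)
  moreover have "cells n m - {?p} = cells n (m(r := m r - 1))"
    by (auto simp: cells_def split: if_splits)
  ultimately show ?thesis by simp
qed

lemma rpp_sum_cells_lower_row: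
  assumes "1 \<le> r" "r < n" and "m r = m (Suc r)" and "c r = Suc (c (Suc r))"
  shows "rpp_sum w (cells n m) (c(r := c r - 1)) = rpp_sum w (cells n m) c"
proof -
  have "k (r, j) \<le> c (Suc r)"
    if k: "k \<in> row_bounded_rpps (cells n m) c" and j: "(r, j) \<in> cells n m" for k j
  proof -
    have below: "(Suc r, j) \<in> cells n m" using j assms by (auto simp: cells_def)
    have "k (r, j) \<le> k (Suc r, j)" by (rule rpps_mono[OF row_bounded_rppsD(1)[OF k] j below]) simp
    also have "\<dots> \<le> c (Suc r)" using row_bounded_rppsD(2)[OF k below] by simp
    finally show ?thesis .
  qed
  then have "row_bounded_rpps (cells n m) (c(r := c r - 1)) = row_bounded_rpps (cells n m) c"
    using assms(4) by (subst row_bounded_rpps_lower_row) auto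
  then show ?thesis by (simp add: rpp_sum_def)
qed

section \<open>Flagged determinants\<close>

definition flag_entry :: "(nat \<Rightarrow> 'a::field) \<Rightarrow> (nat \<Rightarrow> 'a) \<Rightarrow> nat \<Rightarrow> nat \<Rightarrow> nat \<Rightarrow> 'a" where
  "flag_entry x y a b i =
     (if i \<le> b then (\<Prod>k = 1..a. x i - y k) / (\<Prod>k = i + 1..b. x i - x k) else 0)"

definition flag_det ::
    "(nat \<Rightarrow> 'a::field) \<Rightarrow> (nat \<Rightarrow> 'a) \<Rightarrow> nat \<Rightarrow> (nat \<Rightarrow> nat) \<Rightarrow> (nat \<Rightarrow> nat) \<Rightarrow> 'a" where
  "flag_det x y n a b =
     det (mat n n (\<lambda>(i, j). flag_entry x y (a (Suc j)) (b (Suc j)) (Suc i)))"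

definition shape_det ::
    "(nat \<Rightarrow> 'a::field) \<Rightarrow> (nat \<Rightarrow> 'a) \<Rightarrow> nat \<Rightarrow> (nat \<Rightarrow> nat) \<Rightarrow> (nat \<Rightarrow> nat) \<Rightarrow> 'a" where
  "shape_det x y n m c = flag_det x y n (\<lambda>i. m i + c i) (\<lambda>i. i + c i)"

lemma flag_entry_Suc:
  fixes x y :: "nat \<Rightarrow> 'a::field"
  assumes inj: "inj_on x {1..n}" and i: "1 \<le> i" and b: "b < n"
  shows "flag_entry x y (Suc a) (Suc b) i
    = flag_entry x y a b i + (x (Suc b) - y (Suc a)) * flag_entry x y a (Suc b) i"
proof -
  consider "i \<le> b" | "i = Suc b" | "Suc b < i" by linarith
  then show ?thesis
  proof cases
    case 1
    have ne: "x i - x (Suc b) \<noteq> 0"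
      using inj_onD[OF inj, of i "Suc b"] i b 1 by auto
    have "(\<Prod>k = i + 1..Suc b. x i - x k) = (\<Prod>k = i + 1..b. x i - x k) * (x i - x (Suc b))"
      using 1 by (simp add: prod.nat_ivl_Suc')
    moreover have "p * (x i - y (Suc a)) / (q * (x i - x (Suc b)))
        = p / q + (x (Suc b) - y (Suc a)) * (p / (q * (x i - x (Suc b))))" for p q
      using ne by (cases "q = 0") (simp_all add: divide_simps, simp add: algebra_simps)
    ultimately show ?thesis using 1 by (simp add: flag_entry_def)
  qed (auto simp: flag_entry_def)
qed

lemma det_linear_column:
  fixes A :: "'a::comm_ring_1 mat"
  assumes carrier: "A \<in> carrier_mat n n" "B \<in> carrier_mat n n" "C \<in> carrier_mat n n"
    and r: "r < n" and column: "\<And>i. i < n \<Longrightarrow> A $$ (i, r) = B $$ (i, r) + z * C $$ (i, r)"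
    and B: "\<And>i j. i < n \<Longrightarrow> j < n \<Longrightarrow> j \<noteq> r \<Longrightarrow> B $$ (i, j) = A $$ (i, j)"
    and C: "\<And>i j. i < n \<Longrightarrow> j < n \<Longrightarrow> j \<noteq> r \<Longrightarrow> C $$ (i, j) = A $$ (i, j)"
  shows "det A = det B + z * det C"
proof -
  have cofactor_eq: "cofactor M i r = cofactor A i r"
    if "M \<in> carrier_mat n n" "\<And>i j. i < n \<Longrightarrow> j < n \<Longrightarrow> j \<noteq> r \<Longrightarrow> M $$ (i, j) = A $$ (i, j)"
    for M i
  proof -
    have "mat_delete M i r = mat_delete A i r"
      by (rule eq_matI) (use that carrier r in \<open>auto simp: mat_delete_def\<close>)
    then show ?thesis by (simp add: cofactor_def)
  qed
  have "det M = (\<Sum>i<n. M $$ (i, r) * cofactor M i r)" if "M \<in> carrier_mat n n" for M :: "'a mat"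
    by (rule laplace_expansion_column[OF that r])
  then show ?thesis
    using carrier cofactor_eq[OF carrier(2) B] cofactor_eq[OF carrier(3) C]
    by (simp add: column sum_distrib_left sum.distrib algebra_simps)
qed

lemma flag_det_decrement_column:
  fixes x y :: "nat \<Rightarrow> 'a::field"
  assumes inj: "inj_on x {1..n}" and r: "1 \<le> r" "r \<le> n" and a: "0 < a r" and b: "0 < b r" "b r \<le> n"
  shows "flag_det x y n a b = flag_det x y n (a(r := a r - 1)) (b(r := b r - 1))
    + (x (b r) - y (a r)) * flag_det x y n (a(r := a r - 1)) b"
proof -
  let ?M = "\<lambda>a b. mat n n (\<lambda>(i, j). flag_entry x y (a (Suc j)) (b (Suc j)) (Suc i))"
  let ?a' = "a(r := a r - 1)" and ?b' = "b(r := b r - 1)"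
  have "det (?M a b) = det (?M ?a' ?b') + (x (b r) - y (a r)) * det (?M ?a' b)"
  proof (rule det_linear_column[where r = "r - 1"])
    fix i assume "i < n"
    then show "?M a b $$ (i, r - 1)
        = ?M ?a' ?b' $$ (i, r - 1) + (x (b r) - y (a r)) * ?M ?a' b $$ (i, r - 1)"
      using flag_entry_Suc[OF inj, of "Suc i" "b r - 1" y "a r - 1"] r a b by simp
  qed (use r in auto)
  then show ?thesis by (simp only: flag_det_def)
qed

lemma shape_det_remove_corner:
  fixes x y :: "nat \<Rightarrow> 'a::field"
  assumes inj: "inj_on x {1..n}" and r: "1 \<le> r" "r + c r \<le> n" and pos: "0 < c r" "0 < m r"
  shows "shape_det x y n m c = shape_det x y n m (c(r := c r - 1))
    + (x (r + c r) - y (m r + c r)) * shape_det x y n (m(r := m r - 1)) c"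
proof -
  have "(\<lambda>i. m i + c i)(r := m r + c r - 1) = (\<lambda>i. m i + (c(r := c r - 1)) i)"
    and "(\<lambda>i. m i + c i)(r := m r + c r - 1) = (\<lambda>i. (m(r := m r - 1)) i + c i)"
    and "(\<lambda>i. i + c i)(r := r + c r - 1) = (\<lambda>i. i + (c(r := c r - 1)) i)"
    using pos by auto
  then show ?thesis
    unfolding shape_det_def
    using flag_det_decrement_column[OF inj, of r "\<lambda>i. m i + c i" "\<lambda>i. i + c i" y] r pos
    by (simp del: fun_upd_apply)
qed

lemma shape_det_lower_row:
  fixes x y :: "nat \<Rightarrow> 'a::field"
  assumes inj: "inj_on x {1..n}" and r: "1 \<le> r" "r < n" "r + c r \<le> n"
    and m: "m r = m (Suc r)" and c: "c r = Suc (c (Suc r))"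
  shows "shape_det x y n m (c(r := c r - 1)) = shape_det x y n m c"
proof -
  let ?a = "(\<lambda>i. m i + c i)(r := m r + c r - 1)"
  have "?a = (\<lambda>i. m i + (c(r := c r - 1)) i)"
    and "(\<lambda>i. i + c i)(r := r + c r - 1) = (\<lambda>i. i + (c(r := c r - 1)) i)"
    using c by auto
  moreover have "flag_det x y n ?a (\<lambda>i. i + c i) = 0"
    unfolding flag_det_def
    by (rule det_identical_columns[of _ n "r - 1" r]) (use r m c in auto)
  ultimately show ?thesis
    unfolding shape_det_def
    using flag_det_decrement_column[OF inj, of r "\<lambda>i. m i + c i" "\<lambda>i. i + c i" y] r c
    by (simp del: fun_upd_apply)
qed

lemma flag_det_triangular:
  assumes "\<And>i. 1 \<le> i \<Longrightarrow> i \<le> n \<Longrightarrow> b i = i"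
  shows "flag_det x y n a b = (\<Prod>i = 1..n. \<Prod>j = 1..a i. x i - y j)"
proof -
  let ?A = "mat n n (\<lambda>(i, j). flag_entry x y (a (Suc j)) (b (Suc j)) (Suc i))"
  have "det ?A = prod_list (diag_mat ?A)"
    by (rule det_upper_triangular) (auto simp: upper_triangular_def flag_entry_def assms)
  also have "\<dots> = (\<Prod>i<n. ?A $$ (i, i))"
    by (simp add: prod_list_diag_prod atLeast0LessThan)
  also have "\<dots> = (\<Prod>i<n. \<Prod>j = 1..a (Suc i). x (Suc i) - y j)"
    by (intro prod.cong) (auto simp: flag_entry_def assms)
  also have "\<dots> = (\<Prod>i = 1..n. \<Prod>j = 1..a i. x i - y j)"
    by (rule prod.reindex_bij_witness[of _ "\<lambda>i. i - 1" Suc]) auto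
  finally show ?thesis unfolding flag_det_def .
qed

lemma mono_on_flag_decrement:
  fixes c :: "nat \<Rightarrow> nat"
  assumes flag: "mono_on {1..n} (\<lambda>i. i + c i)" and mono: "mono_on {1..r} c"
    and r: "1 \<le> r" "r \<le> n" and pos: "0 < c r"
  shows "mono_on {1..n} (\<lambda>i. i + (c(r := c r - 1)) i)"
proof -
  have "mono_on {1..n} ((\<lambda>i. i + c i)(r := r + (c r - 1)))"
  proof (rule monotone_on_fun_upd)
    show "i + c i \<le> r + (c r - 1)" if "i \<in> {1..n}" "i \<noteq> r" "i \<le> r" for i
    proof -
      have "c i \<le> c r" by (rule monotone_onD[OF mono]) (use that r in auto)
      then show ?thesis using that pos by linarith
    qed
    show "r + (c r - 1) \<le> i + c i" if "i \<in> {1..n}" "i \<noteq> r" "r \<le> i" for i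
      using monotone_onD[OF flag, of r i] that r by simp
  qed (use monotone_on_subset[OF flag] in auto)
  also have "(\<lambda>i. i + c i)(r := r + (c r - 1)) = (\<lambda>i. i + (c(r := c r - 1)) i)" by auto
  finally show ?thesis .
qed

lemma antimono_on_corner_decrement:
  fixes m :: "nat \<Rightarrow> nat"
  assumes m: "antimono_on {1..n} m" and r: "r < n" and corner: "m (Suc r) < m r"
  shows "antimono_on {1..n} (m(r := m r - 1))"
proof (rule monotone_on_fun_upd)
  show "m i \<le> m r - 1" if "i \<in> {1..n}" "i \<noteq> r" "r \<le> i" for i
    using monotone_onD[OF m, of "Suc r" i] that corner by auto
  show "m r - 1 \<le> m i" if "i \<in> {1..n}" "i \<noteq> r" "i \<le> r" for i
    using monotone_onD[OF m, of i r] that r by auto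
qed (use monotone_on_subset[OF m] in auto)

lemma rpp_sum_eq_shape_det_zero_bound:
  assumes c: "\<And>i. 1 \<le> i \<Longrightarrow> i \<le> n \<Longrightarrow> c i = 0"
  shows "rpp_sum (\<lambda>(i, j). x i - y j) (cells n m) c = shape_det x y n m c"
proof -
  have "rpp_sum (\<lambda>(i, j). x i - y j) (cells n m) c = (\<Prod>(i, j) \<in> cells n m. x i - y j)"
    by (rule rpp_sum_zero_bound) (use c in \<open>auto simp: cells_def\<close>)
  also have "\<dots> = (\<Prod>i = 1..n. \<Prod>j = 1..m i + c i. x i - y j)"
    using c by (simp add: cells_def prod.Sigma[symmetric])
  also have "\<dots> = shape_det x y n m c"
    unfolding shape_det_def by (rule flag_det_triangular[symmetric]) (simp add: c)
  finally show ?thesis .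
qed

lemma rpp_sum_eq_shape_det_descent:
  fixes x y :: "nat \<Rightarrow> 'a::field"
  assumes inj: "inj_on x {1..n}" and m: "antimono_on {1..n} m"
    and r: "1 \<le> r" "r < n" and c: "mono_on {1..r} c" "c r = Suc (c (Suc r))" "r + c r \<le> n"
    and lower: "rpp_sum (\<lambda>(i, j). x i - y j) (cells n m) (c(r := c r - 1))
      = shape_det x y n m (c(r := c r - 1))"
    and remove: "m (Suc r) < m r \<Longrightarrow> rpp_sum (\<lambda>(i, j). x i - y j) (cells n (m(r := m r - 1))) c
      = shape_det x y n (m(r := m r - 1)) c"
  shows "rpp_sum (\<lambda>(i, j). x i - y j) (cells n m) c = shape_det x y n m c" (is "?S m c = ?F m c")
proof (cases "m r = m (Suc r)")
  case True
  have "?S m c = ?S m (c(r := c r - 1))"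
    by (rule rpp_sum_cells_lower_row[OF r True c(2), symmetric])
  also note lower
  also have "?F m (c(r := c r - 1)) = ?F m c"
    by (rule shape_det_lower_row[OF inj r c(3) True c(2)])
  finally show ?thesis .
next
  case False
  then have corner: "m (Suc r) < m r"
    using monotone_onD[OF m, of r "Suc r"] r by simp
  have "?S m c = ?S m (c(r := c r - 1))
      + (x (r + c r) - y (m r + c r)) * ?S (m(r := m r - 1)) c"
    using rpp_sum_cells_remove_corner[OF m r corner c(1), of "\<lambda>(i, j). x i - y j"] c(2)
    by (simp del: fun_upd_apply)
  also have "\<dots> = ?F m c"
    unfolding lower remove[OF corner]
    by (rule shape_det_remove_corner[symmetric]) (use inj r c corner in auto)
  finally show ?thesis .
qed

theorem rpp_sum_eq_shape_det:
  fixes x y :: "nat \<Rightarrow> 'a::field"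
  assumes inj: "inj_on x {1..n}" and "antimono_on {1..n} m"
    and "mono_on {1..n} (\<lambda>i. i + c i)" and "c n = 0"
  shows "rpp_sum (\<lambda>(i, j). x i - y j) (cells n m) c = shape_det x y n m c" (is "?S m c = ?F m c")
  using assms(2-)
proof (induction "(\<Sum>i = 1..n. m i) + (\<Sum>i = 1..n. c i)" arbitrary: m c rule: less_induct)
  case (less m c)
  note m = less.prems(1) and flag = less.prems(2) and c_n = less.prems(3)
  show ?case
  proof (cases "mono_on {1..n} c")
    case True
    then have "c i = 0" if "1 \<le> i" "i \<le> n" for i
      using monotone_onD[OF True, of i n] that c_n by simp
    then show ?thesis by (rule rpp_sum_eq_shape_det_zero_bound)
  next
    case False
    then obtain r where r: "1 \<le> r" "r < n"
      and mono: "mono_on {1..r} c" and descent: "c (Suc r) < c r"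
      by (rule mono_on_first_descent)
    have c_r: "c r = Suc (c (Suc r))"
      using monotone_onD[OF flag, of r "Suc r"] r descent by simp
    have flag_r: "r + c r \<le> n"
      using monotone_onD[OF flag, of r n] r c_n by simp
    let ?m' = "m(r := m r - 1)" and ?c' = "c(r := c r - 1)"
    show ?thesis
    proof (rule rpp_sum_eq_shape_det_descent[OF inj m r mono c_r flag_r])
      have "(\<Sum>i = 1..n. ?c' i) < (\<Sum>i = 1..n. c i)"
        by (rule sum_decrement_less) (use r c_r in auto)
      moreover have "mono_on {1..n} (\<lambda>i. i + ?c' i)"
        by (rule mono_on_flag_decrement) (use flag mono r c_r in auto)
      ultimately show "?S m ?c' = ?F m ?c'"
        using m r c_n by (intro less.hyps) auto
      assume corner: "m (Suc r) < m r"
      have "(\<Sum>i = 1..n. ?m' i) < (\<Sum>i = 1..n. m i)"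
        by (rule sum_decrement_less) (use r corner in auto)
      moreover have "antimono_on {1..n} ?m'"
        by (rule antimono_on_corner_decrement[OF m r(2) corner])
      ultimately show "?S ?m' c = ?F ?m' c"
        using flag c_n by (intro less.hyps) (simp_all del: fun_upd_apply)
    qed
  qed
qed

section \<open>Excited diagrams\<close>

lemma slide_eq_imp_comparable:
  assumes "slide k p = slide h q"
  shows "p \<le> q \<or> q \<le> p"
  using assms by (cases p; cases q) (auto simp: slide_def)

lemma inj_on_slide:
  assumes k: "k \<in> rpps C"
  shows "inj_on (slide k) C"
proof (rule inj_onI)
  fix p q assume pq: "p \<in> C" "q \<in> C" and eq: "slide k p = slide k q"
  then have "k p \<le> k q \<and> p \<le> q \<or> k q \<le> k p \<and> q \<le> p"
    using slide_eq_imp_comparable[OF eq] rpps_mono[OF k] by blast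
  then show "p = q"
    using eq by (cases p; cases q) (auto simp: slide_def)
qed

text \<open>Since \<open>slide k\<close> is strictly increasing on each diagonal, the rows above \<open>p\<close> determine \<open>k p\<close>.\<close>

lemma slide_image_eq_imp_le:
  assumes k: "k \<in> rpps C" and h: "h \<in> rpps C" and eq: "slide k ` C = slide h ` C"
    and p: "p \<in> C" and agree: "\<And>q. q \<in> C \<Longrightarrow> fst q < fst p \<Longrightarrow> k q = h q"
  shows "h p \<le> k p"
proof -
  have "slide k p \<in> slide h ` C" using eq p by blast
  then obtain q where q: "q \<in> C" and pq: "slide k p = slide h q" by blast
  show ?thesis
  proof (cases "fst q < fst p")
    case True
    then have "slide k p = slide k q" using pq agree[OF q] by (simp add: slide_def)
    then have "p = q" using inj_onD[OF inj_on_slide[OF k]] p q by blast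
    then show ?thesis using True by simp
  next
    case False
    then have "p \<le> q" using pq by (cases p; cases q) (auto simp: slide_def)
    then have "h p \<le> h q" by (rule rpps_mono[OF h p q])
    then show ?thesis using pq \<open>p \<le> q\<close> by (cases p; cases q) (auto simp: slide_def)
  qed
qed

lemma inj_on_slide_image: "inj_on (\<lambda>k. slide k ` C) (rpps C)"
proof (rule inj_onI)
  fix k h assume k: "k \<in> rpps C" and h: "h \<in> rpps C" and eq: "slide k ` C = slide h ` C"
  have "p \<in> C \<Longrightarrow> k p = h p" for p
  proof (induction "fst p" arbitrary: p rule: less_induct)
    case less
    show ?case
      using slide_image_eq_imp_le[OF k h eq less.prems] slide_image_eq_imp_le[OF h k _ less.prems]
        less.hyps eq by fastforce
  qed
  then show "k = h" by (rule rpps_eqI[OF k h])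
qed

lemma slide_image_increment:
  assumes k: "k \<in> rpps C" and p: "p \<in> C"
  shows "slide (k(p := Suc (k p))) ` C = insert (slide k p + (1, 1)) (slide k ` C - {slide k p})"
proof -
  let ?k' = "k(p := Suc (k p))"
  have "slide ?k' ` C = insert (slide ?k' p) (slide ?k' ` (C - {p}))"
    using p by (simp add: insert_absorb flip: image_insert)
  also have "slide ?k' p = slide k p + (1, 1)"
    by (cases p) (simp add: slide_def)
  also have "slide ?k' ` (C - {p}) = slide k ` (C - {p})"
    by (rule image_cong) (auto simp: slide_def)
  also have "\<dots> = slide k ` C - {slide k p}"
    using inj_on_image_set_diff[OF inj_on_slide[OF k], of C "{p}"] p by simp
  finally show ?thesis .
qed

lemma rpps_increment_iff:
  assumes k: "k \<in> rpps C" and p: "p \<in> C"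
  shows "k(p := Suc (k p)) \<in> rpps C \<longleftrightarrow> (\<forall>q \<in> C. p < q \<longrightarrow> k p < k q)"
proof
  assume k': "k(p := Suc (k p)) \<in> rpps C"
  show "\<forall>q \<in> C. p < q \<longrightarrow> k p < k q"
    using rpps_mono[OF k' p] by (fastforce simp: less_le)
next
  assume "\<forall>q \<in> C. p < q \<longrightarrow> k p < k q"
  then show "k(p := Suc (k p)) \<in> rpps C"
    by (intro rpps_fun_upd disjI1 k p) (use rpps_mono[OF k _ p] in fastforce)+
qed

lemma free_of_rpps_increment:
  assumes k: "k \<in> rpps C" and p: "p \<in> C" and k': "k(p := Suc (k p)) \<in> rpps C"
    and slide_p: "slide k p = (a, b)" and ef: "e \<le> 1" "f \<le> 1" "e + f \<noteq> 0"
  shows "(a + e, b + f) \<notin> slide k ` C"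
proof
  assume "(a + e, b + f) \<in> slide k ` C"
  then obtain q where q: "q \<in> C" and slide_q: "slide k q = (a + e, b + f)" by force
  obtain i j i' j' where pq: "p = (i, j)" "q = (i', j')" by fastforce
  have row: "i' + k q = i + k p + e" and column: "j' + k q = j + k p + f"
    using slide_p slide_q by (auto simp: slide_def pq)
  show False
  proof (cases "i' \<le> i \<and> j' \<le> j")
    case True
    then have "k q \<le> k p" by (intro rpps_mono[OF k q p]) (simp add: pq)
    then show False using row column True ef by linarith
  next
    case False
    then have le: "i \<le> i'" "j \<le> j'" using row column ef by linarith+
    then have "p < q" using False by (auto simp: pq less_le)
    then have "k p < k q" using k' q unfolding rpps_increment_iff[OF k p] by blast
    then show False using row column le False ef by linarith
  qed
qed

lemma rpps_increment_of_free:
  assumes k: "k \<in> rpps C" and p: "p \<in> C" and slide_p: "slide k p = (a, b)"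
    and convex: "\<And>q r. q \<in> C \<Longrightarrow> p \<le> r \<Longrightarrow> r \<le> q \<Longrightarrow> r \<in> C"
    and free: "(a + 1, b) \<notin> slide k ` C" "(a, b + 1) \<notin> slide k ` C"
  shows "k(p := Suc (k p)) \<in> rpps C"
  unfolding rpps_increment_iff[OF k p]
proof (intro ballI impI)
  have neighbour: "k p < k r" if r: "r \<in> C" "r = p + (1, 0) \<or> r = p + (0, 1)" for r
  proof (rule ccontr)
    assume "\<not> k p < k r"
    moreover have "k p \<le> k r"
      by (rule rpps_mono[OF k p r(1)]) (use r(2) in \<open>cases p, auto\<close>)
    ultimately have "k r = k p" by simp
    then have "slide k r = (a + 1, b) \<or> slide k r = (a, b + 1)"
      using r(2) slide_p by (cases p) (auto simp: slide_def)
    then show False using free r(1) by (metis imageI)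
  qed
  fix q assume q: "q \<in> C" "p < q"
  have "\<exists>r. p \<le> r \<and> r \<le> q \<and> (r = p + (1, 0) \<or> r = p + (0, 1))"
  proof (cases "fst p < fst q")
    case True
    then show ?thesis
      using q(2) by (intro exI[of _ "p + (1, 0)"]) (cases p; cases q; auto simp: less_le)
  next
    case False
    then show ?thesis
      using q(2) by (intro exI[of _ "p + (0, 1)"]) (cases p; cases q; auto simp: less_le)
  qed
  then obtain r where r: "p \<le> r" "r \<le> q" "r = p + (1, 0) \<or> r = p + (0, 1)" by blast
  have "r \<in> C" by (rule convex[OF q(1) r(1,2)])
  then have "k p < k r" using r(3) by (rule neighbour)
  also have "\<dots> \<le> k q" by (rule rpps_mono[OF k \<open>r \<in> C\<close> q(1) r(2)])
  finally show "k p < k q" .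
qed

lemma is_partition_nth_antimono:
  assumes "is_partition \<mu>" "i \<le> j" "j < length \<mu>"
  shows "\<mu> ! j \<le> \<mu> ! i"
  using assms sorted_wrt_nth_less[of "(\<ge>)" \<mu> i j] by (cases "i = j") (auto simp: is_partition_def)

lemma diagram_down_closed:
  assumes "is_partition \<mu>" and "q \<in> diagram \<mu>" and "(1, 1) \<le> p" and "p \<le> q"
  shows "p \<in> diagram \<mu>"
proof -
  obtain i j i' j' where pq: "p = (i, j)" "q = (i', j')" by fastforce
  have "\<mu> ! (i' - 1) \<le> \<mu> ! (i - 1)"
    by (rule is_partition_nth_antimono[OF assms(1)]) (use assms(2-) in \<open>auto simp: pq diagram_def\<close>)
  then show ?thesis using assms(2-) by (auto simp: pq diagram_def)
qed

lemma slide_zero: "slide (\<lambda>p. 0) ` C = C"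
  by (simp add: slide_def flip: zero_prod_def)

lemma excited_diagram_is_slide_image:
  assumes \<mu>: "is_partition \<mu>" and subset: "diagram \<mu> \<subseteq> diagram \<Lambda>"
    and D: "D \<in> excited_diagrams \<Lambda> \<mu>"
  obtains k where "k \<in> rpps (diagram \<mu>)" and "slide k ` diagram \<mu> = D" and "D \<subseteq> diagram \<Lambda>"
  using D
proof (induction arbitrary: thesis)
  case base
  then show ?case using zero_in_rpps slide_zero subset by blast
next
  case (excite D a b)
  obtain k where k: "k \<in> rpps (diagram \<mu>)" and D: "slide k ` diagram \<mu> = D" and "D \<subseteq> diagram \<Lambda>"
    by (rule excite.IH)
  obtain p where p: "p \<in> diagram \<mu>" and slide_p: "slide k p = (a, b)"
    using excite.hyps(2) D by force
  have "r \<in> diagram \<mu>" if "q \<in> diagram \<mu>" "p \<le> r" "r \<le> q" for q r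
    by (rule diagram_down_closed[OF \<mu> that(1) _ that(3)])
      (use p that(2) in \<open>cases p; cases r; auto simp: diagram_def\<close>)
  then have "k(p := Suc (k p)) \<in> rpps (diagram \<mu>)"
    by (rule rpps_increment_of_free[OF k p slide_p]) (use excite.hyps(3) D in auto)
  moreover have "slide (k(p := Suc (k p))) ` diagram \<mu> = insert (a + 1, b + 1) (D - {(a, b)})"
    by (simp add: slide_image_increment[OF k p] slide_p D)
  moreover have "insert (a + 1, b + 1) (D - {(a, b)}) \<subseteq> diagram \<Lambda>"
    using \<open>D \<subseteq> diagram \<Lambda>\<close> excite.hyps(3) by auto
  ultimately show ?case by (rule excite.prems)
qed

lemma slide_image_increment_is_excited_diagram:
  assumes \<Lambda>: "is_partition \<Lambda>" and excited: "slide k ` diagram \<mu> \<in> excited_diagrams \<Lambda> \<mu>"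
    and k: "k \<in> rpps (diagram \<mu>)" and p: "p \<in> diagram \<mu>"
    and k': "k(p := Suc (k p)) \<in> rpps (diagram \<mu>)"
    and subset: "slide (k(p := Suc (k p))) ` diagram \<mu> \<subseteq> diagram \<Lambda>"
  shows "slide (k(p := Suc (k p))) ` diagram \<mu> \<in> excited_diagrams \<Lambda> \<mu>"
proof -
  obtain a b where slide_p: "slide k p = (a, b)" by fastforce
  have image: "slide (k(p := Suc (k p))) ` diagram \<mu>
      = insert (a + 1, b + 1) (slide k ` diagram \<mu> - {(a, b)})"
    using slide_image_increment[OF k p] slide_p by simp
  have "(1, 1) \<le> (a, b)"
    using p slide_p by (cases p) (auto simp: slide_def diagram_def)
  then have room: "{(a + 1, b), (a, b + 1), (a + 1, b + 1)} \<subseteq> diagram \<Lambda>"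
    using diagram_down_closed[OF \<Lambda>, of "(a + 1, b + 1)"] subset unfolding image by auto
  have free: "(a + e, b + f) \<notin> slide k ` diagram \<mu>" if "e \<le> 1" "f \<le> 1" "e + f \<noteq> 0" for e f
    by (rule free_of_rpps_increment[OF k p k' slide_p that])
  have "{(a + 1, b), (a, b + 1), (a + 1, b + 1)} \<inter> slide k ` diagram \<mu> = {}"
    using free[of 1 0] free[of 0 1] free[of 1 1] by auto
  moreover have "(a, b) \<in> slide k ` diagram \<mu>" using p slide_p by force
  ultimately show ?thesis
    unfolding image using room by (intro excited_diagrams.excite[OF excited]) auto
qed

text \<open>The last excitation is undone at a minimal cell among those that have moved.\<close>

lemma slide_image_is_excited_diagram:
  assumes \<Lambda>: "is_partition \<Lambda>"
    and "k \<in> rpps (diagram \<mu>)" and "slide k ` diagram \<mu> \<subseteq> diagram \<Lambda>"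
  shows "slide k ` diagram \<mu> \<in> excited_diagrams \<Lambda> \<mu>"
  using assms(2-)
proof (induction "\<Sum>p \<in> diagram \<mu>. k p" arbitrary: k rule: less_induct)
  case (less k)
  note k = less.prems(1) and subset = less.prems(2)
  let ?moved = "{p \<in> diagram \<mu>. 0 < k p}"
  show ?case
  proof (cases "?moved = {}")
    case True
    then have "k = (\<lambda>p. 0)" by (intro rpps_eqI[OF k zero_in_rpps]) auto
    then show ?thesis by (simp add: slide_zero excited_diagrams.base)
  next
    case False
    then obtain p where "p \<in> ?moved" and minimal: "\<And>q. q \<in> ?moved \<Longrightarrow> q \<le> p \<Longrightarrow> p = q"
      using finite_has_minimal[of ?moved] finite_diagram[of \<mu>] by auto
    then have p: "p \<in> diagram \<mu>" "0 < k p" by auto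
    have unmoved: "k q = 0" if "q \<in> diagram \<mu>" "q < p" for q
    proof (rule ccontr)
      assume "k q \<noteq> 0"
      then have "q \<in> ?moved" using that by simp
      then have "p = q" by (rule minimal) (use that in simp)
      then show False using that by simp
    qed
    define h where "h = k(p := k p - 1)"
    have k_eq: "k = h(p := Suc (h p))" using p by (auto simp: h_def)
    have h: "h \<in> rpps (diagram \<mu>)"
      unfolding h_def using unmoved rpps_mono[OF k p(1)]
      by (intro rpps_fun_upd disjI1 k p(1)) fastforce+
    have "slide h q \<in> diagram \<Lambda>" if "q \<in> diagram \<mu>" for q
    proof (rule diagram_down_closed[OF \<Lambda>])
      show "slide k q \<in> diagram \<Lambda>" using subset that by blast
    qed (use that in \<open>cases q; auto simp: slide_def h_def diagram_def\<close>)+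
    moreover have "(\<Sum>q \<in> diagram \<mu>. h q) < (\<Sum>q \<in> diagram \<mu>. k q)"
      unfolding h_def by (rule sum_decrement_less) (use p finite_diagram in auto)
    ultimately have "slide h ` diagram \<mu> \<in> excited_diagrams \<Lambda> \<mu>"
      using h by (intro less.hyps) auto
    then show ?thesis
      by (rule slide_image_increment_is_excited_diagram[OF \<Lambda> _ h p(1), folded k_eq, OF _ k subset])
  qed
qed

theorem excited_diagrams_eq_slide_images:
  assumes "is_partition \<mu>" and "is_partition \<Lambda>" and "diagram \<mu> \<subseteq> diagram \<Lambda>"
  shows "excited_diagrams \<Lambda> \<mu> =
    (\<lambda>k. slide k ` diagram \<mu>) ` {k \<in> rpps (diagram \<mu>). slide k ` diagram \<mu> \<subseteq> diagram \<Lambda>}"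
proof (intro equalityI subsetI)
  fix D assume "D \<in> excited_diagrams \<Lambda> \<mu>"
  then obtain k where "k \<in> rpps (diagram \<mu>)" "slide k ` diagram \<mu> = D" "D \<subseteq> diagram \<Lambda>"
    by (rule excited_diagram_is_slide_image[OF assms(1,3)])
  then show "D \<in> (\<lambda>k. slide k ` diagram \<mu>)
      ` {k \<in> rpps (diagram \<mu>). slide k ` diagram \<mu> \<subseteq> diagram \<Lambda>}" by auto
qed (auto intro: slide_image_is_excited_diagram assms(2))

corollary sum_excited_diagrams:
  assumes "is_partition \<mu>" and "is_partition \<Lambda>" and "diagram \<mu> \<subseteq> diagram \<Lambda>"
  shows "(\<Sum>D \<in> excited_diagrams \<Lambda> \<mu>. \<Prod>p \<in> D. w p) =
    (\<Sum>k \<in> {k \<in> rpps (diagram \<mu>). slide k ` diagram \<mu> \<subseteq> diagram \<Lambda>}.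
      \<Prod>p \<in> diagram \<mu>. w (slide k p))"
proof -
  let ?K = "{k \<in> rpps (diagram \<mu>). slide k ` diagram \<mu> \<subseteq> diagram \<Lambda>}"
  have "inj_on (\<lambda>k. slide k ` diagram \<mu>) ?K"
    by (rule inj_on_subset[OF inj_on_slide_image]) auto
  then show ?thesis
    unfolding excited_diagrams_eq_slide_images[OF assms]
    by (auto simp: sum.reindex prod.reindex[OF inj_on_slide] intro!: sum.cong)
qed

section \<open>The outer shape\<close>

definition parts :: "nat list \<Rightarrow> nat \<Rightarrow> nat" where
  "parts \<mu> i = (if i \<le> length \<mu> then \<mu> ! (i - 1) else 0)"

lemma antimono_on_parts: "is_partition \<mu> \<Longrightarrow> antimono_on {1..n} (parts \<mu>)"
  by (auto simp: monotone_on_def parts_def intro: is_partition_nth_antimono)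

lemma diagram_eq_cells: "length \<mu> \<le> n \<Longrightarrow> diagram \<mu> = cells n (parts \<mu>)"
  by (auto simp: diagram_def cells_def parts_def split: if_splits)

lemma length_outer_shape: "length (outer_shape \<mu> d) = d + length \<mu>"
  by (simp add: outer_shape_def)

text \<open>In the \<open>d\<close> initial rows, \<open>i - d\<close> truncates to 0.\<close>

lemma nth_outer_shape: "i < d + length \<mu> \<Longrightarrow> outer_shape \<mu> d ! i = \<mu> ! (i - d) + d"
  by (auto simp: outer_shape_def nth_append)

lemma is_partition_outer_shape:
  assumes "is_partition \<mu>" and "\<mu> \<noteq> []"
  shows "is_partition (outer_shape \<mu> d)"
proof -
  have "sorted_wrt (\<ge>) (outer_shape \<mu> d)"
    unfolding sorted_wrt_iff_nth_less length_outer_shape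
  proof (intro allI impI)
    fix i j assume ij: "i < j" "j < d + length \<mu>"
    moreover have "0 < length \<mu>" using assms(2) by simp
    ultimately have "\<mu> ! (j - d) \<le> \<mu> ! (i - d)"
      by (intro is_partition_nth_antimono[OF assms(1)]) linarith+
    then show "outer_shape \<mu> d ! j \<le> outer_shape \<mu> d ! i"
      using ij by (simp add: nth_outer_shape)
  qed
  moreover have "0 < p" if "p \<in> set (outer_shape \<mu> d)" for p
    using that assms by (auto simp: outer_shape_def is_partition_def)
  ultimately show ?thesis by (simp add: is_partition_def)
qed

lemma slide_image_subset_outer_shape_iff:
  assumes \<mu>: "is_partition \<mu>" and k: "k \<in> rpps (diagram \<mu>)"
  shows "slide k ` diagram \<mu> \<subseteq> diagram (outer_shape \<mu> d) \<longleftrightarrow> (\<forall>p \<in> diagram \<mu>. k p \<le> d)"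
proof (intro iffI ballI subsetI)
  fix p assume subset: "slide k ` diagram \<mu> \<subseteq> diagram (outer_shape \<mu> d)" and p: "p \<in> diagram \<mu>"
  define i where "i = fst p"
  let ?last = "(i, \<mu> ! (i - 1))"
  have i: "1 \<le> i" "i \<le> length \<mu>" and last: "?last \<in> diagram \<mu>" "p \<le> ?last"
    using p by (cases p; auto simp: diagram_def i_def)+
  have "slide k ?last \<in> diagram (outer_shape \<mu> d)" using subset last(1) by blast
  then have row: "i + k ?last \<le> d + length \<mu>"
    and column: "\<mu> ! (i - 1) + k ?last \<le> outer_shape \<mu> d ! (i + k ?last - 1)"
    by (auto simp: slide_def diagram_def length_outer_shape)
  have "k ?last \<le> d"
  proof (rule ccontr)
    assume large: "\<not> ?thesis"
    then have "\<mu> ! (i + k ?last - 1 - d) \<le> \<mu> ! (i - 1)"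
      using i row by (intro is_partition_nth_antimono[OF \<mu>]) auto
    then show False
      using column row i large by (simp add: nth_outer_shape)
  qed
  then show "k p \<le> d" using rpps_mono[OF k p last] by simp
next
  fix q assume bound: "\<forall>p \<in> diagram \<mu>. k p \<le> d" and "q \<in> slide k ` diagram \<mu>"
  then obtain i j where p: "(i, j) \<in> diagram \<mu>" and q: "q = slide k (i, j)" by auto
  have "k (i, j) \<le> d" using bound p by blast
  moreover have "\<mu> ! (i - 1) \<le> \<mu> ! (i + k (i, j) - 1 - d)"
    using p calculation by (intro is_partition_nth_antimono[OF \<mu>]) (auto simp: diagram_def)
  ultimately show "q \<in> diagram (outer_shape \<mu> d)"
    using p by (auto simp: q slide_def diagram_def length_outer_shape nth_outer_shape)
qed

lemma A_entry_eq_flag_entry: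
  assumes "1 \<le> i" "i \<le> d + length \<mu>" "1 \<le> j" "j \<le> d + length \<mu>"
  defines "c \<equiv> min d (d + length \<mu> - j)"
  shows "A_entry x y \<mu> d i j = flag_entry x y (parts \<mu> j + c) (j + c) i"
  using assms by (auto simp: A_entry_def flag_entry_def parts_def Let_def min_def add.commute)

lemma sum_excited_diagrams_outer_shape:
  assumes \<mu>: "is_partition \<mu>" "\<mu> \<noteq> []" and c: "\<And>i. 1 \<le> i \<Longrightarrow> i \<le> length \<mu> \<Longrightarrow> c i = d"
  shows "(\<Sum>D \<in> excited_diagrams (outer_shape \<mu> d) \<mu>. \<Prod>p \<in> D. w p) = rpp_sum w (diagram \<mu>) c"
proof -
  have bound: "c (fst p) = d" if "p \<in> diagram \<mu>" for p
    using that c by (auto simp: diagram_def)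
  have "diagram \<mu> \<subseteq> diagram (outer_shape \<mu> d)"
    using slide_image_subset_outer_shape_iff[OF \<mu>(1) zero_in_rpps] by (simp add: slide_zero)
  moreover have "{k \<in> rpps (diagram \<mu>). slide k ` diagram \<mu> \<subseteq> diagram (outer_shape \<mu> d)}
      = row_bounded_rpps (diagram \<mu>) c"
    by (simp add: row_bounded_rpps_def bound slide_image_subset_outer_shape_iff[OF \<mu>(1)]
        cong: conj_cong)
  ultimately show ?thesis
    by (simp add: sum_excited_diagrams is_partition_outer_shape \<mu> rpp_sum_def)
qed

theorem theorem7p6:
  fixes x y :: "nat \<Rightarrow> 'a::field" and \<mu> :: "nat list" and l d :: nat
  assumes "is_partition \<mu>" and "length \<mu> = l" and "l \<ge> 1"
    and "inj_on x {1..d + l}"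
  shows "(\<Sum>D \<in> excited_diagrams (outer_shape \<mu> d) \<mu>. \<Prod>(i, j) \<in> D. x i - y j)
    = det (mat (d + l) (d + l) (\<lambda>(i, j). A_entry x y \<mu> d (i + 1) (j + 1)))"
proof -
  \<comment> \<open>A row \<open>j > l\<close> is empty, so its bound is arbitrary; this one makes column \<open>j\<close> end at \<open>d + l\<close>.\<close>
  define c where "c j = min d (d + l - j)" for j
  have "(\<Sum>D \<in> excited_diagrams (outer_shape \<mu> d) \<mu>. \<Prod>(i, j) \<in> D. x i - y j)
      = rpp_sum (\<lambda>(i, j). x i - y j) (diagram \<mu>) c"
    by (rule sum_excited_diagrams_outer_shape) (use assms in \<open>auto simp: c_def\<close>)
  also have "diagram \<mu> = cells (d + l) (parts \<mu>)"
    by (rule diagram_eq_cells) (simp add: assms(2))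
  also have "rpp_sum (\<lambda>(i, j). x i - y j) (cells (d + l) (parts \<mu>)) c
      = shape_det x y (d + l) (parts \<mu>) c"
    by (rule rpp_sum_eq_shape_det[OF assms(4) antimono_on_parts[OF assms(1)]])
      (auto simp: c_def monotone_on_def)
  also have "\<dots> = det (mat (d + l) (d + l) (\<lambda>(i, j). A_entry x y \<mu> d (i + 1) (j + 1)))"
    unfolding shape_det_def flag_det_def using assms(2)
    by (intro arg_cong[where f = det] eq_matI) (auto simp: A_entry_eq_flag_entry c_def)
  finally show ?thesis .
qed

end
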